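(* Let $\beta,\gamma$ be real numbers such that $\gamma<0$ and $1\leq\beta+\gamma\leq 2$. Then for every graph $G$, the polynomial $Z_G(x)$ has no zero in the disk $\{z\in\mathbb{C}:|z|<\frac{\beta-1}{1-\gamma}\}$. Furthermore, $\frac{\beta-1}{1-\gamma}$ is the maximum possible radius such that this zero-freeness holds for all graphs $G$ (i.e., for every $r>\frac{\beta-1}{1-\gamma}$ there is a graph $G$ with $Z_G(x)$ having a zero in $\{z:|z|<r\}$).
   Context: Graphs are finite undirected multigraphs, possibly with self-loops and parallel edges. For fixed $\beta,\gamma$, let $A=\begin{bmatrix}\beta&1\\1&\gamma\end{bmatrix}$. For a graph $G=(V,E)$ define the univariate polynomial $Z_G(x)=\sum_{\sigma\in\{0,1\}^V}\prod_{\{u,v\}\in E}A_{\sigma(u),\sigma(v)}\prod_{v\in V}x^{\sigma(v)}$. *)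

theory Defs
  imports
    "HOL-Analysis.Analysis"
    "HOL-Library.Uprod"
    "HOL-Library.Multiset"
    "HOL-Library.FuncSet"
    "HOL-Computational_Algebra.Polynomial"
begin

text \<open>
  Edges form a multiset of unordered pairs: the pair \<open>Upair v v\<close> is a self-loop at \<open>v\<close>, and
  multiplicities account for parallel edges.
\<close>

locale multigraph =
  fixes V :: "'a set" and E :: "'a uprod multiset"
  assumes finite_verts: "finite V"
    and edge_ends: "\<And>e. e \<in># E \<Longrightarrow> set_uprod e \<subseteq> V"

text \<open>
  The matrix with rows \<open>(\<beta>, 1)\<close> and \<open>(1, \<gamma>)\<close>, indexed by \<open>0\<close> and \<open>1\<close>.  It is symmetric, so its
  entry at an unordered pair of indices is well defined (\<open>case_uprod\<close>).
\<close>

lift_definition interaction :: "'b::one \<Rightarrow> 'b \<Rightarrow> (nat, 'b) commute"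
  is "\<lambda>\<beta> \<gamma> i j. if i = 0 \<and> j = 0 then \<beta> else if i = 1 \<and> j = 1 then \<gamma> else 1"
  by auto

definition edge_weight :: "'b::one \<Rightarrow> 'b \<Rightarrow> ('a \<Rightarrow> nat) \<Rightarrow> 'a uprod \<Rightarrow> 'b"
  where "edge_weight \<beta> \<gamma> \<sigma> e = case_uprod (interaction \<beta> \<gamma>) (map_uprod \<sigma> e)"

lemma edge_weight_Upair [simp]:
  "edge_weight \<beta> \<gamma> \<sigma> (Upair u v) =
    (if \<sigma> u = 0 \<and> \<sigma> v = 0 then \<beta> else if \<sigma> u = 1 \<and> \<sigma> v = 1 then \<gamma> else 1)"
  by (simp add: edge_weight_def interaction.rep_eq)

definition partition_poly ::
    "'b::comm_semiring_1 \<Rightarrow> 'b \<Rightarrow> 'a set \<Rightarrow> 'a uprod multiset \<Rightarrow> 'b poly"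
  where "partition_poly \<beta> \<gamma> V E =
    (\<Sum>\<sigma> \<in> V \<rightarrow>\<^sub>E {0, 1}.
      smult (\<Prod>e\<in>#E. edge_weight \<beta> \<gamma> \<sigma> e) (\<Prod>v\<in>V. monom 1 1 ^ \<sigma> v))"

end

theory Submission
  imports Defs
begin

text \<open>
  Write \<open>R = (\<beta> - 1) / (1 - \<gamma>)\<close>. Zero-freeness holds for the multivariate partition function with
  all activities in \<open>|x\<^sub>v| < R\<close>, by induction on the number of edges. For a non-loop edge with ends \<open>u, v\<close>,
  deleting it leaves a polynomial \<open>a + b y + c w + d y w\<close> in the activities of \<open>u\<close> and \<open>v\<close> without
  zeros in \<open>|y|, |w| < R\<close>, and contracting it shows that \<open>a + d t\<close> has no zero in \<open>|t| < R\<close>. Hence, at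
  given \<open>y, w\<close>, the polynomial \<open>a + (b y + c w) t + d y w t\<^sup>2\<close> factors as \<open>a (1 - p t) (1 - q t)\<close>
  with \<open>|p|, |q| < 1\<close> and \<open>|p q| < R\<close>, and this forces \<open>\<beta> a + b y + c w + \<gamma> d y w \<noteq> 0\<close>. A loop merely
  multiplies an activity by \<open>\<gamma> / \<beta>\<close>, and \<open>|\<gamma>| \<le> \<beta>\<close>. Optimality is witnessed by stars, whose
  polynomial is \<open>(\<beta> + x)\<^sup>n + x (1 + \<gamma> x)\<^sup>n\<close>.
\<close>

section \<open>Multivariate partition function and expansion over the spins of one or two
  vertices\<close>

text \<open>The weight \<open>g\<close> is left arbitrary: fixing a spin or pulling out the factor
  of an edge then only changes \<open>g\<close>.\<close>

definition spin_sum :: "'a set \<Rightarrow> ('a \<Rightarrow> 'b::comm_semiring_1) \<Rightarrow> (('a \<Rightarrow> nat) \<Rightarrow> 'b) \<Rightarrow> 'b"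
  where "spin_sum V x g = (\<Sum>\<sigma> \<in> V \<rightarrow>\<^sub>E {0, 1}. g \<sigma> * (\<Prod>v\<in>V. x v ^ \<sigma> v))"

definition partition_fun ::
    "'b::comm_semiring_1 \<Rightarrow> 'b \<Rightarrow> 'a set \<Rightarrow> 'a uprod multiset \<Rightarrow> ('a \<Rightarrow> 'b) \<Rightarrow> 'b"
  where "partition_fun \<beta> \<gamma> V E x = spin_sum V x (\<lambda>\<sigma>. \<Prod>e\<in>#E. edge_weight \<beta> \<gamma> \<sigma> e)"

lemma poly_partition_poly:
  fixes \<beta> \<gamma> z :: "'b::comm_ring_1"
  shows "poly (partition_poly \<beta> \<gamma> V E) z = partition_fun \<beta> \<gamma> V E (\<lambda>_. z)"
  by (simp add: partition_poly_def partition_fun_def spin_sum_def poly_sum poly_prod poly_monom)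

lemma sum_PiE_insert:
  assumes "v \<notin> W"
  shows "(\<Sum>\<sigma> \<in> insert v W \<rightarrow>\<^sub>E S. f \<sigma>) = (\<Sum>i\<in>S. \<Sum>\<sigma> \<in> W \<rightarrow>\<^sub>E S. f (\<sigma>(v := i)))"
proof -
  have "(\<Sum>\<sigma> \<in> insert v W \<rightarrow>\<^sub>E S. f \<sigma>) = (\<Sum>(i, \<sigma>) \<in> S \<times> (W \<rightarrow>\<^sub>E S). f (\<sigma>(v := i)))"
    unfolding PiE_insert_eq
    by (subst sum.reindex) (use inj_combinator[OF assms] in \<open>auto simp: case_prod_unfold o_def\<close>)
  then show ?thesis
    by (simp add: sum.cartesian_product)
qed

text \<open>Serves contraction: merging two vertices amounts to giving both of them the same
  spin.\<close>

lemma edge_weight_map_uprod: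
  "edge_weight \<beta> \<gamma> \<sigma> (map_uprod f e) = edge_weight \<beta> \<gamma> (\<sigma> \<circ> f) e"
  by (simp add: edge_weight_def uprod.map_comp)

lemma spin_sum_fun_upd [simp]:
  assumes "v \<notin> W"
  shows "spin_sum W (x(v := t)) g = spin_sum W x g"
proof -
  have "(\<Prod>w\<in>W. (x(v := t)) w ^ \<sigma> w) = (\<Prod>w\<in>W. x w ^ \<sigma> w)" for \<sigma>
    using assms by (intro prod.cong) auto
  then show ?thesis
    by (simp add: spin_sum_def del: fun_upd_apply)
qed

lemma spin_sum_mult_left: "spin_sum W x (\<lambda>\<sigma>. k * g \<sigma>) = k * spin_sum W x g"
  by (simp add: spin_sum_def sum_distrib_left mult.assoc)

lemma spin_sum_insert:
  assumes "finite W" "v \<notin> W"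
  shows "spin_sum (insert v W) x g =
    spin_sum W x (\<lambda>\<sigma>. g (\<sigma>(v := 0))) + spin_sum W x (\<lambda>\<sigma>. g (\<sigma>(v := 1))) * x v"
proof -
  have "(\<Prod>w\<in>insert v W. x w ^ (\<sigma>(v := i)) w) = x v ^ i * (\<Prod>w\<in>W. x w ^ \<sigma> w)" for \<sigma> i
  proof -
    have "(\<Prod>w\<in>W. x w ^ (\<sigma>(v := i)) w) = (\<Prod>w\<in>W. x w ^ \<sigma> w)"
      using assms(2) by (intro prod.cong) auto
    then show ?thesis
      using assms by simp
  qed
  then show ?thesis
    unfolding spin_sum_def sum_PiE_insert[OF assms(2)]
    by (simp add: sum_distrib_left mult_ac del: fun_upd_apply)
qed

lemma spin_sum_insert2:
  assumes "finite W" "u \<notin> W" "v \<notin> W" "u \<noteq> v"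
  shows "spin_sum (insert u (insert v W)) x g =
    spin_sum W x (\<lambda>\<sigma>. g (\<sigma>(u := 0, v := 0))) +
    spin_sum W x (\<lambda>\<sigma>. g (\<sigma>(u := 1, v := 0))) * x u +
    spin_sum W x (\<lambda>\<sigma>. g (\<sigma>(u := 0, v := 1))) * x v +
    spin_sum W x (\<lambda>\<sigma>. g (\<sigma>(u := 1, v := 1))) * x u * x v"
  using assms by (simp add: spin_sum_insert fun_upd_twist[of v u] algebra_simps)

section \<open>Complex estimates for adding a single edge\<close>

text \<open>In the application \<open>\<kappa> = 1 - \<gamma>\<close> and
  \<open>\<beta> = 1 + \<kappa> * R\<close>, so the expression is
  \<open>\<beta> - (p + q) + \<gamma> * p * q\<close>. If it vanished,
  \<open>q * (1 + (\<kappa> - 1) * p) = 1 + \<kappa> * R - p\<close>. Comparing moduli, this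
  contradicts \<open>|q| < 1\<close> when \<open>|p| \<le> R\<close>, and \<open>|p q| < R\<close>
  when \<open>|p| > R\<close>.\<close>

lemma quadratic_root_bound_nonzero:
  fixes p q :: complex and \<kappa> R :: real
  assumes "cmod p < 1" "cmod q < 1" "cmod (p * q) < R" "1 \<le> \<kappa>"
  shows "1 + of_real (\<kappa> * R) - (p + q) + of_real (1 - \<kappa>) * (p * q) \<noteq> 0"
proof
  assume "1 + of_real (\<kappa> * R) - (p + q) + of_real (1 - \<kappa>) * (p * q) = 0"
  then have eq: "q * (1 + of_real (\<kappa> - 1) * p) = of_real (1 + \<kappa> * R) - p"
    by (simp add: algebra_simps)
  define r where "r = cmod p"
  have R: "0 < R"
    using assms(3) norm_ge_zero[of "p * q"] by linarith
  have r: "0 \<le> r" "r < 1"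
    using assms by (auto simp: r_def)
  have \<kappa>R: "0 < \<kappa> * R"
    using assms R by simp
  \<comment> \<open>By \<open>eq\<close>, the factor \<open>1 + (\<kappa> - 1) * p\<close> is then
    nonzero too, so it can be cancelled at the end of the case \<open>R < r\<close>.\<close>
  have neq: "of_real (1 + \<kappa> * R) - p \<noteq> 0"
  proof
    assume "of_real (1 + \<kappa> * R) - p = 0"
    then have "p = of_real (1 + \<kappa> * R)"
      by simp
    then have "r = 1 + \<kappa> * R"
      using \<kappa>R by (simp add: r_def del: of_real_add of_real_mult)
    then show False
      using r \<kappa>R by simp
  qed
  show False
  proof (cases "r \<le> R")
    case True
    have "1 + \<kappa> * R - r \<le> cmod (of_real (1 + \<kappa> * R) - p)"
      using norm_triangle_ineq2[of "of_real (1 + \<kappa> * R)" p] \<kappa>R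
      by (simp add: r_def del: of_real_add of_real_mult)
    also have "\<dots> = cmod q * cmod (1 + of_real (\<kappa> - 1) * p)"
      using eq by (metis norm_mult)
    also have "\<dots> \<le> cmod q * (1 + (\<kappa> - 1) * r)"
    proof (rule mult_left_mono)
      show "cmod (1 + of_real (\<kappa> - 1) * p) \<le> 1 + (\<kappa> - 1) * r"
        using norm_triangle_ineq[of 1 "of_real (\<kappa> - 1) * p"] assms(4)
        by (simp add: norm_mult r_def del: of_real_diff)
    qed simp
    also have "\<dots> < 1 * (1 + (\<kappa> - 1) * r)"
      using assms r by (intro mult_strict_right_mono) (auto intro: add_pos_nonneg)
    finally have "\<kappa> * R < \<kappa> * r"
      by (simp add: algebra_simps)
    then show False
      using True assms by simp
  next
    case False
    define c where "c = Re p"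
    have c: "c \<le> r"
      by (simp add: c_def r_def complex_Re_le_cmod)
    have r2: "r\<^sup>2 = c\<^sup>2 + (Im p)\<^sup>2"
      by (simp add: r_def c_def cmod_power2)
    have n1: "(cmod (of_real (1 + \<kappa> * R) - p))\<^sup>2 = (1 + \<kappa> * R)\<^sup>2 - 2 * (1 + \<kappa> * R) * c + r\<^sup>2"
      unfolding r2 cmod_power2 by (simp add: c_def power2_eq_square algebra_simps)
    have n2: "(cmod (1 + of_real (\<kappa> - 1) * p))\<^sup>2 = 1 + 2 * (\<kappa> - 1) * c + (\<kappa> - 1)\<^sup>2 * r\<^sup>2"
      unfolding r2 cmod_power2 by (simp add: c_def power2_eq_square algebra_simps)
    \<comment> \<open>This is the desired modulus inequality at the extremal point
      \<open>p = r\<close>.\<close>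
    have "R * (1 + (\<kappa> - 1) * r) \<le> r * (1 + \<kappa> * R - r)"
    proof -
      have "0 \<le> (r - R) * (1 - r)"
        using False r by simp
      then show ?thesis
        by (simp add: algebra_simps)
    qed
    moreover have "0 \<le> R * (1 + (\<kappa> - 1) * r)"
      using R r assms by simp
    ultimately have "(R * (1 + (\<kappa> - 1) * r))\<^sup>2 \<le> (r * (1 + \<kappa> * R - r))\<^sup>2"
      by (rule power_mono)
    \<comment> \<open>For fixed \<open>r\<close>, the difference of the squared sides is affine and
      decreasing in \<open>c = Re p\<close>; twice this term is what is gained in passing from
      \<open>c = r\<close> to the actual \<open>c\<close>.\<close>
    moreover have "0 \<le> (r\<^sup>2 * (1 + \<kappa> * R) + R\<^sup>2 * (\<kappa> - 1)) * (r - c)"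
      using c \<kappa>R assms by simp
    ultimately have "R\<^sup>2 * (cmod (1 + of_real (\<kappa> - 1) * p))\<^sup>2 \<le> r\<^sup>2 * (cmod (of_real (1 + \<kappa> * R) - p))\<^sup>2"
      unfolding n1 n2 by (simp add: power2_eq_square algebra_simps)
    then have "(R * cmod (1 + of_real (\<kappa> - 1) * p))\<^sup>2 \<le> (r * cmod (of_real (1 + \<kappa> * R) - p))\<^sup>2"
      by (simp add: power_mult_distrib)
    then have "R * cmod (1 + of_real (\<kappa> - 1) * p) \<le> r * cmod (of_real (1 + \<kappa> * R) - p)"
      using r by (auto elim: power2_le_imp_le)
    also have "\<dots> = cmod (p * q) * cmod (1 + of_real (\<kappa> - 1) * p)"
      using eq unfolding r_def by (metis mult.assoc norm_mult)
    finally show False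
      using assms(3) neq eq by (auto simp: mult_le_cancel_right)
  qed
qed

text \<open>Here \<open>p\<close> and \<open>q\<close> are the inverse roots of
  \<open>1 + m t + D t^2\<close>, which makes sense also for \<open>D = 0\<close>.\<close>

lemma quadratic_factorization:
  fixes m D :: complex
  obtains p q where "m = - (p + q)" "D = p * q"
proof
  define s where "s = csqrt (m\<^sup>2 - 4 * D)"
  have "s * s = m\<^sup>2 - 4 * D"
    by (metis power2_csqrt power2_eq_square s_def)
  then show "D = ((- m + s) / 2) * ((- m - s) / 2)"
    by (simp add: algebra_simps power2_eq_square)
  show "m = - ((- m + s) / 2 + (- m - s) / 2)"
    by (simp add: field_simps)
qed

text \<open>\<open>F\<close> is what deleting the edge provides, \<open>C\<close> what contracting
  it provides. \<open>F\<close> bounds the inverse roots \<open>p\<close> and \<open>q\<close>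
  separately, \<open>C\<close> bounds their product, and
  \<open>\<beta> = 1 + (1 - \<gamma>) * R\<close> brings the conclusion into the form of
  \<open>quadratic_root_bound_nonzero\<close>.\<close>

lemma edge_operator_nonzero:
  fixes a b c d y w :: complex and \<beta> \<gamma> :: real
  assumes "\<gamma> < 0" "1 < \<beta>"
    and "cmod y < (\<beta> - 1) / (1 - \<gamma>)" "cmod w < (\<beta> - 1) / (1 - \<gamma>)"
    and F: "\<And>y w. cmod y < (\<beta> - 1) / (1 - \<gamma>) \<Longrightarrow> cmod w < (\<beta> - 1) / (1 - \<gamma>) \<Longrightarrow>
      a + b * y + c * w + d * y * w \<noteq> 0"
    and C: "\<And>t. cmod t < (\<beta> - 1) / (1 - \<gamma>) \<Longrightarrow> a + d * t \<noteq> 0"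
  shows "of_real \<beta> * a + b * y + c * w + of_real \<gamma> * d * y * w \<noteq> 0"
proof -
  define R where "R = (\<beta> - 1) / (1 - \<gamma>)"
  have R: "0 < R" and \<beta>: "\<beta> = 1 + (1 - \<gamma>) * R"
    using assms by (simp_all add: R_def)
  note F = F[folded R_def] and C = C[folded R_def]
  have y: "cmod y < R" and w: "cmod w < R"
    using assms by (simp_all add: R_def)
  have a: "a \<noteq> 0"
    using C[of 0] R by simp
  obtain p q where pq: "(b * y + c * w) / a = - (p + q)" "d * y * w / a = p * q"
    using quadratic_factorization by blast
  have eqs: "b * y + c * w = - (p + q) * a" "d * y * w = p * q * a"
    using pq a by (simp_all add: field_simps)
  \<comment> \<open>Apply \<open>F\<close> along the line \<open>t \<mapsto> (t y, t w)\<close>. The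
    whole closed unit disk is allowed, hence the strict bounds on \<open>p\<close> and
    \<open>q\<close>.\<close>
  have root: "(1 - p * t) * (1 - q * t) \<noteq> 0" if "cmod t \<le> 1" for t
  proof -
    have "cmod (t * y) < R" "cmod (t * w) < R"
      using that y w mult_left_le_one_le[of "cmod y" "cmod t"] mult_left_le_one_le[of "cmod w" "cmod t"]
      by (auto simp: norm_mult)
    from F[OF this] have "a + (b * y + c * w) * t + (d * y * w) * t\<^sup>2 \<noteq> 0"
      by (simp add: algebra_simps power2_eq_square)
    then have "a * ((1 - p * t) * (1 - q * t)) \<noteq> 0"
      unfolding eqs by (simp add: algebra_simps power2_eq_square)
    then show ?thesis
      by simp
  qed
  have small: "cmod p < 1" if "\<And>t. cmod t \<le> 1 \<Longrightarrow> 1 - p * t \<noteq> 0" for p :: complex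
  proof (rule ccontr)
    assume "\<not> cmod p < 1"
    then have "p \<noteq> 0" "cmod (inverse p) \<le> 1"
      by (auto simp: norm_inverse inverse_le_1_iff)
    then show False
      using that[of "inverse p"] by simp
  qed
  have "cmod p < 1" "cmod q < 1"
    using root by (auto intro!: small)
  \<comment> \<open>Otherwise the root \<open>- a / d\<close> of \<open>a + d t\<close> has modulus
    \<open>|y w| / |p q| < R * R / R = R\<close>, against \<open>C\<close>.\<close>
  moreover have "cmod (p * q) < R"
  proof (rule ccontr)
    assume *: "\<not> cmod (p * q) < R"
    then have D: "d * y * w / a \<noteq> 0" "R \<le> cmod (d * y * w / a)"
      using R pq by auto
    then have d: "d \<noteq> 0"
      by auto
    have "cmod y * cmod w < R * R"
      using y w by (intro mult_strict_mono') auto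
    moreover have "R * cmod a \<le> cmod d * (cmod y * cmod w)"
      using D a by (simp add: norm_mult norm_divide field_simps)
    ultimately have "R * cmod a < cmod d * (R * R)"
      using d by (smt (verit) mult_less_cancel_left_pos zero_less_norm_iff)
    then have "cmod (- a / d) < R"
      using R d by (simp add: norm_divide field_simps)
    from C[OF this] show False
      using d by simp
  qed
  ultimately have "1 + of_real ((1 - \<gamma>) * R) - (p + q) + of_real (1 - (1 - \<gamma>)) * (p * q) \<noteq> 0"
    using assms by (intro quadratic_root_bound_nonzero) auto
  then have "a * (of_real \<beta> - (p + q) + of_real \<gamma> * (p * q)) \<noteq> 0"
    using a by (subst \<beta>) simp
  also have "a * (of_real \<beta> - (p + q) + of_real \<gamma> * (p * q)) =
      of_real \<beta> * a + (b * y + c * w) + of_real \<gamma> * (d * y * w)"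
    unfolding eqs by (simp add: algebra_simps)
  finally show ?thesis
    by (simp add: algebra_simps)
qed

section \<open>Zero-freeness by induction on the number of edges\<close>

text \<open>Each vertex has its own activity because the induction step varies those at the ends of
  one edge while the others stay fixed. The vertex set is generalised because contraction removes a
  vertex.\<close>

lemma partition_fun_nonzero:
  fixes \<beta> \<gamma> :: real and x :: "'a \<Rightarrow> complex"
  assumes "\<gamma> < 0" "1 \<le> \<beta> + \<gamma>" "\<beta> + \<gamma> \<le> 2"
    and "multigraph V E"
    and "\<And>v. v \<in> V \<Longrightarrow> cmod (x v) < (\<beta> - 1) / (1 - \<gamma>)"
  shows "partition_fun (complex_of_real \<beta>) (complex_of_real \<gamma>) V E x \<noteq> 0"
  using assms(4,5)
proof (induction "size E" arbitrary: V E x)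
  case 0
  define R where "R = (\<beta> - 1) / (1 - \<gamma>)"
  \<comment> \<open>Equivalent to \<open>\<beta> + \<gamma> \<le> 2\<close>; it keeps the zero
    \<open>-1\<close> of an isolated vertex out of the open disk.\<close>
  have R: "R \<le> 1"
    using assms by (simp add: R_def)
  have "finite V"
    using 0 by (simp add: multigraph_def)
  then have "partition_fun (complex_of_real \<beta>) (complex_of_real \<gamma>) V E x = (\<Prod>v\<in>V. 1 + x v)"
    using 0(1) prod_sum_PiE[of V "\<lambda>_. {0, 1::nat}" "\<lambda>v i. x v ^ i"]
    by (simp add: partition_fun_def spin_sum_def)
  moreover have "1 + x v \<noteq> 0" if "v \<in> V" for v
  proof
    assume "1 + x v = 0"
    then have "x v = - 1"
      by (simp add: add_eq_0_iff)
    then show False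
      using 0(3)[OF that] R by (simp add: R_def)
  qed
  ultimately show ?case
    using \<open>finite V\<close> by simp
next
  case (Suc n)
  define R where "R = (\<beta> - 1) / (1 - \<gamma>)"
  have R: "0 < R" and \<beta>1: "1 < \<beta>"
    using assms by (simp_all add: R_def)
  obtain e E0 where E: "E = add_mset e E0"
    using Suc(2) by (metis size_eq_Suc_imp_eq_union)
  have n: "n = size E0"
    using Suc(2) E by simp
  have fin: "finite V"
    using Suc.prems by (simp add: multigraph_def)
  have mE0: "multigraph V E0"
    using Suc.prems by (auto simp: multigraph_def E)
  obtain u v where e: "e = Upair u v"
    by (cases e)
  have uv: "u \<in> V" "v \<in> V"
    using Suc.prems by (auto simp: multigraph_def E e)
  note IH = Suc.hyps(1)[folded R_def]
  have x: "cmod (x v) < R" if "v \<in> V" for v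
    using Suc.prems(2)[OF that] by (simp add: R_def)
  show ?case
  proof (cases "u = v")
    case True
    define W where "W = V - {v}"
    have V: "V = insert v W" and W: "finite W" "v \<notin> W"
      using uv fin by (auto simp: W_def)
    define c where "c i = spin_sum W x (\<lambda>\<sigma>.
      \<Prod>e\<in>#E0. edge_weight (complex_of_real \<beta>) (complex_of_real \<gamma>) (\<sigma>(v := i)) e)" for i
    have E0: "c 0 + c 1 * t \<noteq> 0" if "cmod t < R" for t
    proof -
      have "partition_fun (complex_of_real \<beta>) (complex_of_real \<gamma>) V E0 (x(v := t)) = c 0 + c 1 * t"
        unfolding V partition_fun_def spin_sum_insert[OF W] c_def using W by simp
      moreover have "partition_fun (complex_of_real \<beta>) (complex_of_real \<gamma>) V E0 (x(v := t)) \<noteq> 0"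
        using x that by (intro IH n mE0) auto
      ultimately show ?thesis
        by simp
    qed
    have "partition_fun (complex_of_real \<beta>) (complex_of_real \<gamma>) V E x =
        of_real \<beta> * c 0 + of_real \<gamma> * c 1 * x v"
      unfolding V partition_fun_def spin_sum_insert[OF W] c_def E e True
      by (simp add: spin_sum_mult_left)
    also have "\<dots> = of_real \<beta> * (c 0 + c 1 * (of_real (\<gamma> / \<beta>) * x v))"
      using \<beta>1 by (simp add: field_simps)
    also have "\<dots> \<noteq> 0"
    proof -
      \<comment> \<open>From \<open>\<beta> + \<gamma> \<ge> 1\<close>:
        \<open>- \<gamma> \<le> \<beta> - 1 < \<beta>\<close>.\<close>
      have "\<bar>\<gamma> / \<beta>\<bar> \<le> 1"
        using assms(1,2) \<beta>1 by (simp add: abs_le_iff field_simps)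
      then have "cmod (of_real (\<gamma> / \<beta>) * x v) \<le> cmod (x v)"
        unfolding norm_mult norm_of_real by (intro mult_left_le_one_le) auto
      then have "cmod (of_real (\<gamma> / \<beta>) * x v) < R"
        using x uv by force
      from E0[OF this] show ?thesis
        using \<beta>1 by simp
    qed
    finally show ?thesis .
  next
    case False
    define W where "W = V - {u, v}"
    have V: "V = insert u (insert v W)" and W: "finite W" "u \<notin> W" "v \<notin> W" "u \<noteq> v"
      using uv fin False by (auto simp: W_def)
    define c where "c i j = spin_sum W x (\<lambda>\<sigma>.
      \<Prod>e\<in>#E0. edge_weight (complex_of_real \<beta>) (complex_of_real \<gamma>) (\<sigma>(u := i, v := j)) e)" for i j
    have deletion: "c 0 0 + c 1 0 * s + c 0 1 * t + c 1 1 * s * t \<noteq> 0"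
      if "cmod s < R" "cmod t < R" for s t
    proof -
      have "partition_fun (complex_of_real \<beta>) (complex_of_real \<gamma>) V E0 (x(u := s, v := t)) =
          c 0 0 + c 1 0 * s + c 0 1 * t + c 1 1 * s * t"
        unfolding V partition_fun_def spin_sum_insert2[OF W] c_def using W by simp
      moreover have "partition_fun (complex_of_real \<beta>) (complex_of_real \<gamma>) V E0 (x(u := s, v := t)) \<noteq> 0"
        using x that by (intro IH n mE0) auto
      ultimately show ?thesis
        by simp
    qed
    have contraction: "c 0 0 + c 1 1 * t \<noteq> 0" if "cmod t < R" for t
    proof -
      \<comment> \<open>Edges of \<open>E0\<close> parallel to the contracted one become loops at
        \<open>u\<close>. No edge is lost, so \<open>E'\<close> has \<open>n\<close> edges; only
        equal spins at \<open>u\<close> and \<open>v\<close> survive, and the merged vertex carries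
        the single activity \<open>t\<close>.\<close>
      define E' where "E' = image_mset (map_uprod (id(v := u))) E0"
      have merge: "\<sigma>(u := i) \<circ> id(v := u) = \<sigma>(u := i, v := i)" for \<sigma> :: "'a \<Rightarrow> nat" and i
        by auto
      have "partition_fun (complex_of_real \<beta>) (complex_of_real \<gamma>) (insert u W) E' (x(u := t)) =
          c 0 0 + c 1 1 * t"
        unfolding partition_fun_def spin_sum_insert[OF W(1,2)] c_def E'_def
        using W by (simp add: image_mset.compositionality comp_def[of _ "map_uprod _"]
            edge_weight_map_uprod merge)
      moreover have "multigraph (insert u W) E'"
        using mE0 W by (fastforce simp: multigraph_def E'_def uprod.set_map V)
      then have "partition_fun (complex_of_real \<beta>) (complex_of_real \<gamma>) (insert u W) E' (x(u := t)) \<noteq> 0"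
        using x that by (intro IH) (auto simp: n E'_def V)
      ultimately show ?thesis
        by simp
    qed
    have "partition_fun (complex_of_real \<beta>) (complex_of_real \<gamma>) V E x =
        of_real \<beta> * c 0 0 + c 1 0 * x u + c 0 1 * x v + of_real \<gamma> * c 1 1 * x u * x v"
      unfolding V partition_fun_def spin_sum_insert2[OF W] c_def E e
      using W by (simp add: spin_sum_mult_left)
    also have "\<dots> \<noteq> 0"
      using assms(1) \<beta>1 x[OF uv(1)] x[OF uv(2)] deletion contraction
      unfolding R_def by (intro edge_operator_nonzero)
    finally show ?thesis .
  qed
qed

section \<open>Optimality of the radius: star graphs\<close>

definition star_edges :: "nat \<Rightarrow> nat uprod multiset"
  where "star_edges n = image_mset (Upair 0) (mset_set {1..n})"

lemma multigraph_star: "multigraph {0..n} (star_edges n)"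
  by (auto simp: multigraph_def star_edges_def)

text \<open>Once the spin of the centre \<open>0\<close> is fixed, the leaves are independent and
  the sum factors into \<open>n\<close> equal terms: \<open>\<beta> + z\<close> for spin 0,
  \<open>1 + \<gamma> * z\<close> for spin 1.\<close>

lemma partition_fun_star:
  fixes \<beta> \<gamma> z :: "'b::comm_ring_1"
  shows "partition_fun \<beta> \<gamma> {0..n} (star_edges n) (\<lambda>_. z) = (\<beta> + z) ^ n + z * (1 + \<gamma> * z) ^ n"
proof -
  have V: "{0..n} = insert 0 {1..n}"
    by auto
  have edges: "(\<Prod>e\<in>#star_edges n. edge_weight \<beta> \<gamma> (\<sigma>(0 := i)) e) =
      (\<Prod>k=1..n. edge_weight \<beta> \<gamma> id (Upair i (\<sigma> k)))" for \<sigma> i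
    unfolding star_edges_def
    by (simp add: multiset.map_comp o_def prod_unfold_prod_mset[symmetric]) (intro prod.cong; simp)
  have "spin_sum {1..n} (\<lambda>_. z) (\<lambda>\<sigma>. \<Prod>e\<in>#star_edges n. edge_weight \<beta> \<gamma> (\<sigma>(0 := i)) e) =
      (\<Sum>j\<in>{0, 1}. edge_weight \<beta> \<gamma> id (Upair i j) * z ^ j) ^ n" for i
    using prod_sum_PiE[of "{1..n}" "\<lambda>_. {0, 1::nat}" "\<lambda>_ j. edge_weight \<beta> \<gamma> id (Upair i j) * z ^ j"]
    unfolding spin_sum_def edges prod.distrib[symmetric] by simp
  then show ?thesis
    unfolding V partition_fun_def by (subst spin_sum_insert) (simp_all add: mult.commute)
qed

text \<open>
  At \<open>x = -R\<close> the two factors \<open>\<beta> + x\<close> and \<open>1 + \<gamma> x\<close> agree; just to the left of it the second one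
  is larger, so a large power makes the star polynomial negative.
\<close>
lemma star_real_root:
  fixes \<beta> \<gamma> r :: real
  assumes "\<gamma> < 0" "1 \<le> \<beta> + \<gamma>" "\<beta> + \<gamma> \<le> 2" "r > (\<beta> - 1) / (1 - \<gamma>)"
  obtains n x where "\<bar>x\<bar> < r" "(\<beta> + x) ^ n + x * (1 + \<gamma> * x) ^ n = 0"
proof -
  define R where "R = (\<beta> - 1) / (1 - \<gamma>)"
  have R: "0 < R" "R \<le> 1" "R < r"
    using assms by (simp_all add: R_def)
  have \<beta>: "1 < \<beta>" "\<beta> - 1 = (1 - \<gamma>) * R"
    using assms by (simp_all add: R_def)
  show thesis
  proof (cases "R = 1")
    case True
    \<comment> \<open>The star with \<open>n = 0\<close> is an isolated vertex with polynomial
      \<open>1 + x\<close>, so \<open>x = -1\<close> is a root.\<close>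
    then show ?thesis
      using R that[of "- 1" 0] by simp
  next
    case False
    \<comment> \<open>Strictly between \<open>R\<close> and \<open>min r 1\<close>:
      \<open>s < r\<close> keeps \<open>-s\<close> in the disk, \<open>s < 1\<close> makes
      \<open>\<beta> - s\<close> positive, and \<open>R < s\<close> makes the ratio of the two
      factors exceed 1.\<close>
    define s where "s = (R + min r 1) / 2"
    have s: "R < s" "s < r" "s < 1"
      using R False by (auto simp: s_def min_def)
    define f where "f n x = (\<beta> + x) ^ n + x * (1 + \<gamma> * x) ^ n" for n x
    have pos: "0 < \<beta> - s"
      using \<beta> s by simp
    have "(1 - \<gamma>) * R < (1 - \<gamma>) * s"
      using s assms by simp
    then have "1 < (1 - \<gamma> * s) / (\<beta> - s)"
      using pos \<beta>(2) by (simp add: field_simps)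
    then obtain n where "1 / s < ((1 - \<gamma> * s) / (\<beta> - s)) ^ n"
      using real_arch_pow by blast
    then have "f n (- s) < 0"
      using pos s R by (simp add: f_def power_divide field_simps)
    moreover have "0 \<le> f n (- R)"
    proof -
      have "1 + \<gamma> * (- R) = \<beta> + (- R)"
        using \<beta>(2) by (simp add: algebra_simps)
      then have "f n (- R) = (\<beta> + (- R)) ^ n + (- R) * (\<beta> + (- R)) ^ n"
        by (simp only: f_def)
      also have "\<dots> = (1 - R) * (\<beta> - R) ^ n"
        by (simp add: algebra_simps)
      finally show ?thesis
        using R \<beta> by simp
    qed
    ultimately have "\<exists>x\<ge>- s. x \<le> - R \<and> f n x = 0"
      using s by (intro IVT') (auto simp: f_def intro!: continuous_intros)
    then show ?thesis
      using that R s by (force simp: f_def)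
  qed
qed

theorem theorem5:
  fixes \<beta> \<gamma> :: real
  assumes "\<gamma> < 0" and "1 \<le> \<beta> + \<gamma>" and "\<beta> + \<gamma> \<le> 2"
  shows "(\<forall>(V :: 'a set) E. multigraph V E \<longrightarrow>
            (\<forall>z :: complex. cmod z < (\<beta> - 1) / (1 - \<gamma>) \<longrightarrow>
               poly (partition_poly (complex_of_real \<beta>) (complex_of_real \<gamma>) V E) z \<noteq> 0)) \<and>
         (\<forall>r :: real. r > (\<beta> - 1) / (1 - \<gamma>) \<longrightarrow>
            (\<exists>(V :: nat set) E. multigraph V E \<and>
               (\<exists>z :: complex. cmod z < r \<and>
                  poly (partition_poly (complex_of_real \<beta>) (complex_of_real \<gamma>) V E) z = 0)))"
proof (intro conjI allI impI)
  fix V :: "'a set" and E and z :: complex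
  assume "multigraph V E" "cmod z < (\<beta> - 1) / (1 - \<gamma>)"
  then show "poly (partition_poly (complex_of_real \<beta>) (complex_of_real \<gamma>) V E) z \<noteq> 0"
    unfolding poly_partition_poly using assms by (intro partition_fun_nonzero) auto
next
  fix r :: real
  assume "r > (\<beta> - 1) / (1 - \<gamma>)"
  then obtain n x where x: "\<bar>x\<bar> < r" "(\<beta> + x) ^ n + x * (1 + \<gamma> * x) ^ n = 0"
    using star_real_root[OF assms] by blast
  have "poly (partition_poly (complex_of_real \<beta>) (complex_of_real \<gamma>) {0..n} (star_edges n)) (of_real x) =
      of_real ((\<beta> + x) ^ n + x * (1 + \<gamma> * x) ^ n)"
    unfolding poly_partition_poly partition_fun_star by simp
  then show "\<exists>(V :: nat set) E. multigraph V E \<and> (\<exists>z :: complex. cmod z < r \<and>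
      poly (partition_poly (complex_of_real \<beta>) (complex_of_real \<gamma>) V E) z = 0)"
    using x multigraph_star[of n] by (metis norm_of_real of_real_0)
qed

end
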